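(* Let $q=p^s$ be a prime power ($p$ prime, $s\ge 1$), $m\ge 2$ an integer, and $t=(q^m-1)/(q-1)$. Let $\mathcal{H}_1,\dots,\mathcal{H}_t$ be the parallel classes of lines of $EG(m,q)$, and for $i=1,\dots,t$ let $\mathbf{A}_i$ be the $q^{m-1}\times q^m$ binary incidence matrix of the lines in $\mathcal{H}_i$ (rows) versus all points of $EG(m,q)$ (columns). Let $$\mathbf{A}_i^{orth}=\begin{cases}\mathbf{A}_i, & \text{if } q \text{ is even and } q\ge 4,\\ [\,\mathbf{A}_i\,|\,\mathbf{I}\,], & \text{if } q \text{ is odd},\\ [\,\mathbf{A}_i\,|\,\mathbf{I}\,|\,\mathbf{I}\,], & \text{if } q=2,\end{cases}\qquad \mathbf{S}_i=\begin{pmatrix}\mathbf{A}_i^{orth} & \mathbf{O}\\ \mathbf{O} & \mathbf{A}_i^{orth}\end{pmatrix}.$$ Then for every $i=1,\dots,t$ the QLDPC code $Q_i$ with stabilizer $\mathbf{S}_i$ has parameters $[[n_3,k_3,d_3]]$, where $$(n_3,k_3,d_3)=\begin{cases}(q^m,\ q^m-2q^{m-1},\ 2), & \text{if } q \text{ is even with } q\ge 4,\\ (q^m+q^{m-1},\ q^m-q^{m-1},\ 2), & \text{if } q \text{ is odd},\\ (2^{m+1},\ 2^m,\ 2), & \text{if } q=2.\end{cases}$$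
   Context: $EG(m,q)$ is the $m$-dimensional Euclidean (affine) geometry over the finite field $\mathbf{F}_q$: its points are the $q^m$ vectors of $\mathbf{F}_q^m$, and its lines are the $1$-dimensional subspaces of $\mathbf{F}_q^m$ and their cosets. A parallel class consists of all $q^{m-1}$ cosets of one fixed $1$-dimensional subspace; there are $t=(q^m-1)/(q-1)$ parallel classes. The $(l,v)$ entry of $\mathbf{A}_i$ is $1$ if line $l$ passes through point $v$ and $0$ otherwise. All matrices are over $\mathbf{F}_2$. $\mathbf{I}$ is the $q^{m-1}\times q^{m-1}$ identity matrix, $\mathbf{O}$ is a zero matrix, and $|$ denotes horizontal concatenation. Quantum codes: a tensor product of $n$ Pauli matrices is represented by a binary vector of length $2n$ (the left half recording one of the $X$/$Z$ parts, the right half the other). Given a set of pairwise commuting such operators, represented by the rows of a binary matrix $\mathbf{S}$ with $2n$ columns, the quantum code with stabilizer $\mathbf{S}$ is the joint $+1$ eigenspace of these operators. Convention for parameters (CSS construction): if $\mathbf{H}$ is a parity check matrix of a binary linear $[n,k,d]$ code (length $n$, dimension $k$, minimum Hamming distance $d$) with $\mathbf{H}\mathbf{H}^T=\mathbf{O}$, then the quantum code with stabilizer $\begin{pmatrix}\mathbf{H}&\mathbf{O}\\ \mathbf{O}&\mathbf{H}\end{pmatrix}$ has parameters $[[n,2k-n,d]]$. *)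

theory Defs
  imports
    "Jordan_Normal_Form.Matrix_Kernel"
    "HOL-Library.Z2"
    "HOL-Library.Cardinality"
    "HOL-Computational_Algebra.Primes"
begin

definition linear_subspace :: "nat \<Rightarrow> 'a::field vec set \<Rightarrow> bool" where
  "linear_subspace n W \<longleftrightarrow> VectorSpace.subspace class_ring W (module_vec TYPE('a) n)"

definition subspace_dim :: "nat \<Rightarrow> 'a::field vec set \<Rightarrow> nat" where
  "subspace_dim n W = vectorspace.dim class_ring ((module_vec TYPE('a) n)\<lparr>carrier := W\<rparr>)"


subsection \<open>Lines and parallel classes of the Euclidean geometry\<close>

text \<open>The point set of the geometry is \<^term>\<open>carrier_vec m\<close> over a finite field.\<close>

definition coset :: "'a::field vec set \<Rightarrow> 'a vec \<Rightarrow> 'a vec set" where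
  "coset W v = (\<lambda>w. v + w) ` W"

definition parallel_class :: "nat \<Rightarrow> 'a::field vec set \<Rightarrow> 'a vec set set" where
  "parallel_class m W = coset W ` carrier_vec m"

definition parallel_classes :: "nat \<Rightarrow> 'a::field vec set set set" where
  "parallel_classes m = parallel_class m ` {W. linear_subspace m W \<and> subspace_dim m W = 1}"

definition incidence_matrix :: "'p set list \<Rightarrow> 'p list \<Rightarrow> bit mat" where
  "incidence_matrix ls ps =
     mat (length ls) (length ps) (\<lambda>(l, v). if ps ! v \<in> ls ! l then 1 else 0)"


subsection \<open>Block matrices\<close>

definition hconcat :: "'a::zero mat \<Rightarrow> 'a mat \<Rightarrow> 'a mat" where
  "hconcat A B = four_block_mat A B (0\<^sub>m 0 (dim_col A)) (0\<^sub>m 0 (dim_col B))"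

definition orth_matrix :: "nat \<Rightarrow> nat \<Rightarrow> bit mat \<Rightarrow> bit mat" where
  "orth_matrix q m A =
     (if even q \<and> 4 \<le> q then A
      else if odd q then hconcat A (1\<^sub>m (q ^ (m - 1)))
      else hconcat A (hconcat (1\<^sub>m (q ^ (m - 1))) (1\<^sub>m (q ^ (m - 1)))))"

definition css_stabilizer :: "bit mat \<Rightarrow> bit mat" where
  "css_stabilizer H =
     four_block_mat H (0\<^sub>m (dim_row H) (dim_col H)) (0\<^sub>m (dim_row H) (dim_col H)) H"


subsection \<open>Binary linear codes\<close>

definition hamming_distance :: "'a vec \<Rightarrow> 'a vec \<Rightarrow> nat" where
  "hamming_distance x y = card {i. i < dim_vec x \<and> x $ i \<noteq> y $ i}"

definition minimum_distance :: "'a vec set \<Rightarrow> nat \<Rightarrow> bool" where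
  "minimum_distance C d \<longleftrightarrow>
     (\<exists>x\<in>C. \<exists>y\<in>C. x \<noteq> y \<and> hamming_distance x y = d) \<and>
     (\<forall>x\<in>C. \<forall>y\<in>C. x \<noteq> y \<longrightarrow> d \<le> hamming_distance x y)"

definition linear_code :: "bit vec set \<Rightarrow> nat \<Rightarrow> nat \<Rightarrow> nat \<Rightarrow> bool" where
  "linear_code C n k d \<longleftrightarrow>
     linear_subspace n C \<and> subspace_dim n C = k \<and> minimum_distance C d"

definition parity_check_matrix :: "bit mat \<Rightarrow> bit vec set \<Rightarrow> bool" where
  "parity_check_matrix H C \<longleftrightarrow> C = mat_kernel H"


subsection \<open>Stabilizer codes\<close>

text \<open>The four matrices are the identity, \<open>X\<close>, \<open>Z\<close> and \<open>Y\<close>.\<close>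

definition pauli :: "bit \<Rightarrow> bit \<Rightarrow> complex mat" where
  "pauli x z =
     (if x = 0 \<and> z = 0 then mat_of_rows_list 2 [[1, 0], [0, 1]]
      else if z = 0 then mat_of_rows_list 2 [[0, 1], [1, 0]]
      else if x = 0 then mat_of_rows_list 2 [[1, 0], [0, -1]]
      else mat_of_rows_list 2 [[0, -\<i>], [\<i>, 0]])"

text \<open>
  The tensor product of the \<open>n\<close> Pauli matrices encoded by a vector of length \<open>2n\<close>, whose left half
  is the \<open>X\<close> part and whose right half is the \<open>Z\<close> part. The computational basis states are
  numbered \<open>0, \<dots>, 2 ^ n - 1\<close>, with binary digit \<open>j\<close> of the number being the state of qubit \<open>j\<close>.
\<close>

definition pauli_operator :: "nat \<Rightarrow> bit vec \<Rightarrow> complex mat" where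
  "pauli_operator n w = mat (2 ^ n) (2 ^ n) (\<lambda>(a, b).
     \<Prod>j<n. pauli (w $ j) (w $ (n + j)) $$ (a div 2 ^ j mod 2, b div 2 ^ j mod 2))"

definition commuting_stabilizer :: "nat \<Rightarrow> bit mat \<Rightarrow> bool" where
  "commuting_stabilizer n S \<longleftrightarrow> dim_col S = 2 * n \<and>
     (\<forall>i<dim_row S. \<forall>j<dim_row S.
        pauli_operator n (row S i) * pauli_operator n (row S j) =
        pauli_operator n (row S j) * pauli_operator n (row S i))"

definition quantum_code :: "nat \<Rightarrow> bit mat \<Rightarrow> complex vec set" where
  "quantum_code n S =
     {\<psi> \<in> carrier_vec (2 ^ n). \<forall>i<dim_row S. pauli_operator n (row S i) *\<^sub>v \<psi> = \<psi>}"

text \<open>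
  The quantum code with stabilizer \<open>S\<close> has parameters \<open>[[n, K, d]]\<close> in the sense of the CSS
  construction: \<open>d\<close> is the minimum distance of the underlying classical code (not that of the
  code modulo its dual), and \<open>K = 2k - n\<close>. The dimension of the joint eigenspace is recorded
  explicitly.
\<close>

definition quantum_code_parameters :: "bit mat \<Rightarrow> nat \<Rightarrow> nat \<Rightarrow> nat \<Rightarrow> bool" where
  "quantum_code_parameters S n K d \<longleftrightarrow>
     commuting_stabilizer n S \<and>
     linear_subspace (2 ^ n) (quantum_code n S) \<and>
     subspace_dim (2 ^ n) (quantum_code n S) = 2 ^ K \<and>
     (\<exists>H C k. S = css_stabilizer H \<and>
        H * H\<^sup>T = 0\<^sub>m (dim_row H) (dim_row H) \<and>
        parity_check_matrix H C \<and> linear_code C n k d \<and> int K = 2 * int k - int n)"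

end

theory Submission
  imports Defs "HOL-Library.Nat_Bijection"
begin

text \<open>
  The lines of a parallel class partition the points, and the appended identity matrices put one more
  point on each line. So in all three cases the matrix has exactly one \<open>1\<close> in every column: it
  records a partition of the \<open>n\<close> coordinates into \<open>r\<close> blocks of the same even size. The classical
  code then consists of the words of even weight on every block, which gives dimension \<open>n - r\<close> and
  distance \<open>2\<close>.

  A vector is fixed by the \<open>Z\<close> operators iff it is supported on the basis states of even weight on
  every block, and by the \<open>X\<close> operators iff its coefficients do not change when a block is flipped.
  The quantum code therefore has one dimension for each orbit of even basis states under block flips.
  Normalising one chosen point per block to \<open>0\<close> picks a representative of each orbit, and the value at
  a second chosen point is then forced by parity, so there are \<open>2 ^ (n - 2 * r)\<close> orbits.
\<close>

subsection \<open>Subspaces of coordinate spaces\<close>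

text \<open>Replaces the module-theoretic notion by elementary closure conditions, the form in which
  every later subspace proof is carried out.\<close>

lemma linear_subspace_iff:
  fixes W :: "'a::field vec set"
  shows "linear_subspace n W \<longleftrightarrow> W \<subseteq> carrier_vec n \<and> 0\<^sub>v n \<in> W \<and>
    (\<forall>v\<in>W. \<forall>w\<in>W. v + w \<in> W) \<and> (\<forall>c. \<forall>v\<in>W. c \<cdot>\<^sub>v v \<in> W)"
proof -
  interpret vec_space "TYPE('a)" n .
  show ?thesis
    unfolding linear_subspace_def subspace_def submodule_def
    using vec_vs vec_module
    by (auto simp: module_vec_simps class_ring_simps)
qed

text \<open>\<open>subspace_dim\<close> is computed in the space with carrier restricted to
  \<open>W\<close>. Span and independence of subsets of \<open>W\<close> do not change under this
  restriction, so both may be checked in the ambient space.\<close>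

lemma (in vec_space) subspace_dim_basis:
  assumes W: "linear_subspace n W" and B: "finite B" "B \<subseteq> W"
    and li: "lin_indpt B" and sp: "W \<subseteq> span B"
  shows "subspace_dim n W = card B"
proof -
  have sub: "subspace class_ring W V" using W by (simp add: linear_subspace_def)
  hence sm: "submodule class_ring W V" by (simp add: subspace_def)
  interpret W: vectorspace class_ring "V\<lparr>carrier := W\<rparr>"
    by (rule subspace_is_vs[OF sub])
  have "W.lin_indpt B" using span_li_not_depend(2)[OF B(2) sm] li by simp
  moreover have "W.span B = W"
    using span_li_not_depend(1)[OF B(2) sm] sp span_is_subset[OF B(2) sm] by (metis subset_antisym)
  ultimately have "W.basis B" using B(2) by (simp only: W.basis_def carrier_vs_is_self simp_thms)
  thus ?thesis unfolding subspace_dim_def by (rule W.dim_basis[OF B(1)])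
qed

text \<open>\<open>J\<close> is an information set in the sense of coding theory. On
  \<open>J\<close> the \<open>b j\<close> look like unit vectors, hence are independent; subtracting
  from \<open>w\<close> the combination with coefficients \<open>w $ j\<close> leaves a vector
  vanishing on \<open>J\<close>, hence zero. Both the classical and the quantum dimension are
  obtained this way.\<close>

lemma (in vec_space) subspace_dim_information_set:
  fixes b :: "nat \<Rightarrow> 'a vec"
  assumes W: "linear_subspace n W" and J: "J \<subseteq> {..<n}"
    and b: "\<And>j. j \<in> J \<Longrightarrow> b j \<in> W"
    and delta: "\<And>i j. i \<in> J \<Longrightarrow> j \<in> J \<Longrightarrow> b j $ i = (if i = j then 1 else 0)"
    and zero: "\<And>w. w \<in> W \<Longrightarrow> (\<And>j. j \<in> J \<Longrightarrow> w $ j = 0) \<Longrightarrow> w = 0\<^sub>v n"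
  shows "subspace_dim n W = card J"
proof -
  note W' = W[unfolded linear_subspace_iff]
  have finJ: "finite J" using J finite_subset by blast
  have inj: "inj_on b J"
    using delta by (intro inj_onI) (metis zero_neq_one)
  define B where "B = b ` J"
  have B: "finite B" "B \<subseteq> W" "B \<subseteq> carrier_vec n"
    using finJ b W' by (auto simp: B_def)
  have idx: "lincomb a B $ i = a (b i)" if "i \<in> J" for a i
  proof -
    have "lincomb a B $ i = (\<Sum>x\<in>B. a x * x $ i)"
      using that J B by (intro lincomb_index) auto
    also have "\<dots> = (\<Sum>j\<in>J. a (b j) * b j $ i)"
      unfolding B_def by (subst sum.reindex[OF inj]) simp
    also have "\<dots> = (\<Sum>j\<in>J. if i = j then a (b j) else 0)"
      using delta that by (intro sum.cong) auto
    finally show ?thesis using that finJ by simp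
  qed
  have "lin_indpt B"
  proof (rule finite_lin_indpt2[OF B(1)])
    show "B \<subseteq> carrier_vec n" by (rule B)
    fix a assume "lincomb a B = 0\<^sub>v n"
    then show "\<forall>v\<in>B. a v = 0" using idx[of _ a] J by (fastforce simp: B_def)
  qed
  moreover have "W \<subseteq> span B"
  proof
    fix w assume w: "w \<in> W"
    \<comment> \<open>The coefficient of \<open>b j\<close> is \<open>w $ j\<close>; inverting
      \<open>b\<close> on \<open>J\<close> recovers \<open>j\<close> from the basis vector.\<close>
    define a where "a = (\<lambda>x. w $ (the_inv_into J b x))"
    let ?u = "lincomb a B"
    have sm: "submodule class_ring W V"
      using W by (simp add: linear_subspace_def subspace_def)
    have us: "?u \<in> span B" using B by (auto simp: span_def)
    hence u: "?u \<in> W" using span_is_subset[OF B(2) sm] by auto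
    have carr: "w \<in> carrier_vec n" "?u \<in> carrier_vec n" using w u W' by auto
    have "w + (-1) \<cdot>\<^sub>v ?u = 0\<^sub>v n"
    proof (rule zero)
      show "w + (-1) \<cdot>\<^sub>v ?u \<in> W" using w u W' by auto
      fix j assume j: "j \<in> J"
      hence "j < n" using J by auto
      thus "(w + (-1) \<cdot>\<^sub>v ?u) $ j = 0"
        using carr idx[OF j, of a] j by (simp add: a_def the_inv_into_f_f[OF inj])
    qed
    hence "w $ i = ?u $ i" if "i < n" for i
      using that carr by (auto dest!: arg_cong[of _ _ "\<lambda>v. v $ i"])
    hence "w = ?u" using carr by (intro eq_vecI) auto
    thus "w \<in> span B" using us by simp
  qed
  ultimately have "subspace_dim n W = card B"
    using subspace_dim_basis[OF W B(1,2)] by blast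
  also have "card B = card J" unfolding B_def by (rule card_image[OF inj])
  finally show ?thesis .
qed

text \<open>Coefficient functions on a basis correspond bijectively to the vectors of
  \<open>W\<close>.\<close>

lemma card_linear_subspace:
  fixes W :: "'a::{field,finite} vec set"
  assumes W: "linear_subspace n W" and fW: "finite W"
  shows "card W = CARD('a) ^ subspace_dim n W"
proof -
  interpret vec_space "TYPE('a)" n .
  have sub: "subspace class_ring W V" using W by (simp add: linear_subspace_def)
  interpret W: vectorspace class_ring "V\<lparr>carrier := W\<rparr>"
    by (rule subspace_is_vs[OF sub])
  have "W.fin_dim"
    unfolding W.fin_dim_def
  proof (intro exI[of _ W] conjI)
    show "W.span W = carrier (V\<lparr>carrier := W\<rparr>)"
      using W.in_own_span[of W] W.span_is_subset2[of W] by simp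
  qed (use fW in simp_all)
  then obtain B where B: "finite B" "W.basis B" using W.finite_basis_exists by blast
  have BW: "B \<subseteq> W" using B by (simp add: W.basis_def)
  have ex1: "\<exists>! a. a \<in> B \<rightarrow>\<^sub>E UNIV \<and> W.lincomb a B = w" if "w \<in> W" for w
    using W.basis_criterion[OF B(1)] B(2) BW that by simp
  have "bij_betw (\<lambda>a. W.lincomb a B) (B \<rightarrow>\<^sub>E UNIV) W"
    unfolding bij_betw_def
  proof
    have cl: "W.lincomb a B \<in> W" for a
      using W.lincomb_closed[of B a] BW by simp
    show "inj_on (\<lambda>a. W.lincomb a B) (B \<rightarrow>\<^sub>E UNIV)"
      using ex1 cl by (intro inj_onI) metis
    show "(\<lambda>a. W.lincomb a B) ` (B \<rightarrow>\<^sub>E UNIV) = W"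
      using ex1 cl by (auto simp: image_iff) metis
  qed
  hence "card W = card (B \<rightarrow>\<^sub>E (UNIV :: 'a set))" by (simp add: bij_betw_same_card)
  also have "\<dots> = CARD('a) ^ card B" using B(1) by (simp add: card_PiE)
  also have "card B = subspace_dim n W"
    unfolding subspace_dim_def using W.dim_basis[OF B] by simp
  finally show ?thesis .
qed

lemma finite_carrier_vec: "finite (carrier_vec n :: 'a::finite vec set)"
proof -
  have "carrier_vec n \<subseteq> vec n ` ({..<n} \<rightarrow>\<^sub>E (UNIV :: 'a set))"
  proof
    fix v :: "'a vec" assume "v \<in> carrier_vec n"
    hence "v = vec n (restrict (($) v) {..<n})" by (intro eq_vecI) auto
    thus "v \<in> vec n ` ({..<n} \<rightarrow>\<^sub>E UNIV)" by (rule image_eqI[where f = "vec n"]) simp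
  qed
  thus ?thesis by (rule finite_subset) (intro finite_imageI finite_PiE; simp)
qed

lemma card_carrier_vec: "card (carrier_vec n :: 'a::{field,finite} vec set) = CARD('a) ^ n"
proof -
  interpret vec_space "TYPE('a)" n .
  have "linear_subspace n (carrier_vec n :: 'a vec set)" by (simp add: linear_subspace_iff)
  moreover have "subspace_dim n (carrier_vec n :: 'a vec set) = n"
    using dim_is_n unfolding subspace_dim_def by (simp add: module_vec_def)
  ultimately show ?thesis using card_linear_subspace finite_carrier_vec by metis
qed

subsection \<open>Partition matrices and their codes\<close>

definition partition_matrix :: "nat \<Rightarrow> nat \<Rightarrow> (nat \<Rightarrow> nat) \<Rightarrow> bit mat" where
  "partition_matrix r n f = mat r n (\<lambda>(l, v). if f v = l then 1 else 0)"

lemma dim_partition_matrix [simp]: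
  "dim_row (partition_matrix r n f) = r" "dim_col (partition_matrix r n f) = n"
  by (simp_all add: partition_matrix_def)

lemma of_nat_bit_even: "even m \<Longrightarrow> of_nat m = (0 :: bit)"
  by (auto elim!: evenE)

text \<open>\<open>f\<close> names the block of a coordinate. Two distinct points of each block are
  fixed: \<open>a l\<close> is the dependent coordinate of the classical code and the point
  normalised to 0 in the quantum code, while \<open>b l\<close> absorbs the parity of the
  block.\<close>

locale even_partition =
  fixes n r :: nat and f a b :: "nat \<Rightarrow> nat"
  assumes f_less: "v < n \<Longrightarrow> f v < r"
    and even_card_block: "l < r \<Longrightarrow> even (card {v. v < n \<and> f v = l})"
    and a_less: "l < r \<Longrightarrow> a l < n" and f_a: "l < r \<Longrightarrow> f (a l) = l"
    and b_less: "l < r \<Longrightarrow> b l < n" and f_b: "l < r \<Longrightarrow> f (b l) = l"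
    and a_neq_b: "l < r \<Longrightarrow> a l \<noteq> b l"
begin

abbreviation block :: "nat \<Rightarrow> nat set" where
  "block l \<equiv> {v. v < n \<and> f v = l}"

abbreviation H :: "bit mat" where
  "H \<equiv> partition_matrix r n f"

lemma inj_on_a: "inj_on a {..<r}"
  using f_a by (metis inj_on_inverseI lessThan_iff)

lemma inj_on_b: "inj_on b {..<r}"
  using f_b by (metis inj_on_inverseI lessThan_iff)

lemma a_neq_b': "l < r \<Longrightarrow> k < r \<Longrightarrow> a l \<noteq> b k"
  using f_a f_b a_neq_b by metis

lemma row_H_scalar_prod:
  assumes "l < r" "w \<in> carrier_vec n"
  shows "row H l \<bullet> w = (\<Sum>v\<in>block l. w $ v)"
proof -
  have "row H l \<bullet> w = (\<Sum>v\<in>{0..<n}. if f v = l then w $ v else 0)"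
    unfolding scalar_prod_def using assms by (intro sum.cong) (auto simp: partition_matrix_def)
  also have "\<dots> = (\<Sum>v\<in>{v\<in>{0..<n}. f v = l}. w $ v)"
    by (rule sum.inter_filter[symmetric]) simp
  finally show ?thesis by (simp add: atLeast0LessThan lessThan_def)
qed

text \<open>Different rows have disjoint supports, and a row times itself is the size of its block
  modulo 2.\<close>

lemma H_self_orthogonal: "H * H\<^sup>T = 0\<^sub>m (dim_row H) (dim_row H)"
proof (rule eq_matI; simp)
  fix k l assume kl: "k < r" "l < r"
  have "row H k \<bullet> row H l = (\<Sum>v\<in>block k. row H l $ v)"
    using kl(1) row_carrier[of H l] unfolding dim_partition_matrix by (rule row_H_scalar_prod)
  also have "\<dots> = (\<Sum>v\<in>block k. if k = l then 1 else 0)"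
    using kl by (intro sum.cong) (auto simp: partition_matrix_def)
  also have "\<dots> = 0"
    using of_nat_bit_even[OF even_card_block[OF kl(1)]] by (cases "k = l") simp_all
  finally show "row H k \<bullet> row H l = 0" .
qed

lemma mem_kernel_iff:
  "w \<in> mat_kernel H \<longleftrightarrow> w \<in> carrier_vec n \<and> (\<forall>l<r. (\<Sum>v\<in>block l. w $ v) = 0)"
proof -
  have "H *\<^sub>v w = 0\<^sub>v r \<longleftrightarrow> (\<forall>l<r. (\<Sum>v\<in>block l. w $ v) = 0)" if "w \<in> carrier_vec n"
    using row_H_scalar_prod[OF _ that] by (auto simp: vec_eq_iff)
  thus ?thesis by (auto simp: mat_kernel_def)
qed

lemma linear_subspace_kernel: "linear_subspace n (mat_kernel H)"
  unfolding linear_subspace_iff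
proof (intro conjI allI ballI)
  fix v w assume vw: "v \<in> mat_kernel H" "w \<in> mat_kernel H"
  have "(\<Sum>i\<in>block l. (v + w) $ i) = (\<Sum>i\<in>block l. v $ i) + (\<Sum>i\<in>block l. w $ i)" for l
    using vw unfolding mem_kernel_iff sum.distrib[symmetric] by (intro sum.cong) auto
  thus "v + w \<in> mat_kernel H" using vw by (auto simp: mem_kernel_iff)
next
  fix c v assume v: "v \<in> mat_kernel H"
  have "(\<Sum>i\<in>block l. (c \<cdot>\<^sub>v v) $ i) = c * (\<Sum>i\<in>block l. v $ i)" for l
    using v unfolding mem_kernel_iff sum_distrib_left by (intro sum.cong) auto
  thus "c \<cdot>\<^sub>v v \<in> mat_kernel H" using v by (auto simp: mem_kernel_iff)
qed (auto simp: mem_kernel_iff)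

text \<open>The two ones cancel in their common block. These words supply both a basis of the code
  and its words of weight 2.\<close>

lemma pair_in_kernel:
  assumes "i < n" "j < n" "f i = f j" "i \<noteq> j"
  shows "vec n (\<lambda>v. if v = i \<or> v = j then 1 else 0) \<in> mat_kernel H" (is "?w \<in> _")
proof -
  have "(\<Sum>v\<in>block l. ?w $ v) = 0" for l
  proof -
    have "(\<Sum>v\<in>block l. ?w $ v) = (\<Sum>v\<in>block l. (if v = i then 1 else 0) + (if v = j then 1 else 0))"
      using assms by (intro sum.cong) auto
    also have "\<dots> = (if i \<in> block l then 1 else 0) + (if j \<in> block l then 1 else 0)"
      by (subst sum.distrib, subst (1 2) sum.delta) simp_all
    also have "\<dots> = 0" using assms by simp
    finally show ?thesis .
  qed
  thus ?thesis by (simp add: mem_kernel_iff)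
qed

text \<open>All coordinates except the \<open>a l\<close> form an information set. The basis word
  for \<open>j\<close> has ones at \<open>j\<close> and at the chosen point of its block.\<close>

lemma subspace_dim_kernel: "subspace_dim n (mat_kernel H) = n - r"
proof -
  interpret vec_space "TYPE(bit)" n .
  define J where "J = {..<n} - a ` {..<r}"
  define e :: "nat \<Rightarrow> bit vec" where "e j = vec n (\<lambda>v. if v = j \<or> v = a (f j) then 1 else 0)" for j
  have J: "j < n" "j \<noteq> a l" if "j \<in> J" "l < r" for j l
    using that by (auto simp: J_def)
  have J': "j < n" if "j \<in> J" for j using that by (auto simp: J_def)
  have "subspace_dim n (mat_kernel H) = card J"
  proof (rule subspace_dim_information_set[OF linear_subspace_kernel])
    show "J \<subseteq> {..<n}" by (auto simp: J_def)
    fix j assume j: "j \<in> J"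
    show "e j \<in> mat_kernel H"
      unfolding e_def using J' J j f_less f_a a_less by (intro pair_in_kernel) auto
    fix i assume "i \<in> J"
    thus "e j $ i = (if i = j then 1 else 0)"
      using J' J j f_less by (auto simp: e_def)
  next
    fix w assume w: "w \<in> mat_kernel H" and w0: "\<And>j. j \<in> J \<Longrightarrow> w $ j = 0"
    have "w $ (a l) = 0" if l: "l < r" for l
    proof -
      \<comment> \<open>With all other coordinates of the block zero, the parity check of block
        \<open>l\<close> reads off the value at \<open>a l\<close>.\<close>
      have "0 = (\<Sum>v\<in>block l. w $ v)" using w l by (simp add: mem_kernel_iff)
      also have "\<dots> = (\<Sum>v\<in>block l. if v = a l then w $ a l else 0)"
      proof (intro sum.cong refl)
        fix v assume v: "v \<in> block l"
        have "v \<in> J" if "v \<noteq> a l"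
          using v that f_a by (auto simp: J_def)
        thus "w $ v = (if v = a l then w $ a l else 0)" using w0 by auto
      qed
      also have "\<dots> = w $ a l" using l a_less f_a by simp
      finally show ?thesis by simp
    qed
    hence "w $ v = 0" if "v < n" for v
      using that w0 by (cases "v \<in> J") (auto simp: J_def)
    thus "w = 0\<^sub>v n" using w by (intro eq_vecI) (auto simp: mem_kernel_iff)
  qed
  also have "card J = n - r"
    unfolding J_def using a_less card_image[OF inj_on_a]
    by (subst card_Diff_subset) auto
  finally show ?thesis .
qed

text \<open>The pair \<open>a 0\<close>, \<open>b 0\<close> gives a word of weight 2. Words
  differing in a single position would violate the parity check of the block containing it.\<close>

lemma minimum_distance_kernel:
  assumes "0 < r"
  shows "minimum_distance (mat_kernel H) 2"
  unfolding minimum_distance_def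
proof (intro conjI ballI impI)
  let ?x = "vec n (\<lambda>v. if v = a 0 \<or> v = b 0 then 1 else 0) :: bit vec"
  have ab: "a 0 < n" "b 0 < n" "f (a 0) = f (b 0)" "a 0 \<noteq> b 0"
    using assms a_less b_less f_a f_b a_neq_b by auto
  have "{i. i < dim_vec ?x \<and> ?x $ i \<noteq> 0\<^sub>v n $ i} = {a 0, b 0}"
    using ab by (auto split: if_splits)
  hence "hamming_distance ?x (0\<^sub>v n) = 2" using ab by (simp add: hamming_distance_def)
  moreover have "?x \<noteq> 0\<^sub>v n" using ab by (auto simp: vec_eq_iff)
  moreover have "0\<^sub>v n \<in> mat_kernel H" by (auto simp: mem_kernel_iff)
  ultimately show "\<exists>x\<in>mat_kernel H. \<exists>y\<in>mat_kernel H. x \<noteq> y \<and> hamming_distance x y = 2"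
    using pair_in_kernel[OF ab] by blast
next
  fix x y assume x: "x \<in> mat_kernel H" and y: "y \<in> mat_kernel H" and "x \<noteq> y"
  hence dim: "dim_vec x = n" "dim_vec y = n" by (auto simp: mem_kernel_iff)
  define D where "D = {i. i < n \<and> x $ i \<noteq> y $ i}"
  have "D \<noteq> {}" using \<open>x \<noteq> y\<close> dim by (auto simp: D_def vec_eq_iff)
  then obtain i where i: "i \<in> D" by blast
  have "D \<noteq> {i}"
  proof
    assume D: "D = {i}"
    \<comment> \<open>Over \<open>bit\<close> the sum \<open>x + y\<close> is also the difference,
      so its entries are 1 exactly where the words differ.\<close>
    have "(\<Sum>v\<in>block (f i). x $ v + y $ v) = 0"
      using x y i f_less unfolding sum.distrib by (simp add: mem_kernel_iff D_def)
    moreover have "(\<Sum>v\<in>block (f i). x $ v + y $ v) = (\<Sum>v\<in>block (f i). if v = i then 1 else 0)"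
    proof (intro sum.cong refl)
      fix v assume "v \<in> block (f i)"
      hence "x $ v = y $ v \<longleftrightarrow> v \<noteq> i" using D by (auto simp: D_def)
      thus "x $ v + y $ v = (if v = i then 1 else 0)"
        by (cases "x $ v"; cases "y $ v") (auto split: if_splits)
    qed
    ultimately show False using i by (simp add: D_def)
  qed
  then obtain j where "j \<in> D" "j \<noteq> i" using i by blast
  hence "card {i, j} \<le> card D" using i by (intro card_mono) (auto simp: D_def)
  thus "2 \<le> hamming_distance x y"
    using \<open>j \<noteq> i\<close> by (simp add: hamming_distance_def D_def dim)
qed

lemma linear_code_kernel: "0 < r \<Longrightarrow> linear_code (mat_kernel H) n (n - r) 2"
  by (simp add: linear_code_def linear_subspace_kernel subspace_dim_kernel minimum_distance_kernel)

end

subsection \<open>Pauli operators as monomial matrices\<close>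

lemma less_power2_iff_set_decode: "c < 2 ^ n \<longleftrightarrow> set_decode c \<subseteq> {..<n}"
proof
  assume c: "c < 2 ^ n"
  have "c div 2 ^ j = 0" if "n \<le> j" for j
    using c that by (meson div_less less_le_trans one_le_numeral power_increasing)
  hence "j < n" if "odd (c div 2 ^ j)" for j
    using that by (metis even_zero not_less)
  thus "set_decode c \<subseteq> {..<n}" by (auto simp: set_decode_def)
next
  assume "set_decode c \<subseteq> {..<n}"
  hence "set_encode (set_decode c) \<le> (\<Sum>j<n. 2 ^ j)"
    unfolding set_encode_def by (intro sum_mono2) auto
  also have "\<dots> < 2 ^ n" by (induction n) auto
  finally show "c < 2 ^ n" by simp
qed

text \<open>Row \<open>c\<close> has its only possible nonzero entry in column
  \<open>\<sigma> c\<close>. The X rows will have all entries \<open>s c\<close> equal to 1, the Z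
  rows will have \<open>\<sigma>\<close> equal to the identity.\<close>

definition monomial_mat :: "nat \<Rightarrow> (nat \<Rightarrow> nat) \<Rightarrow> (nat \<Rightarrow> complex) \<Rightarrow> complex mat" where
  "monomial_mat N \<sigma> s = mat N N (\<lambda>(c, d). if d = \<sigma> c then s c else 0)"

lemma dim_monomial_mat [simp]:
  "dim_row (monomial_mat N \<sigma> s) = N" "dim_col (monomial_mat N \<sigma> s) = N"
  by (simp_all add: monomial_mat_def)

lemma monomial_mat_row_scalar_prod:
  assumes "i < N" "\<sigma> i < N" "v \<in> carrier_vec N"
  shows "row (monomial_mat N \<sigma> s) i \<bullet> v = s i * v $ \<sigma> i"
proof -
  have "row (monomial_mat N \<sigma> s) i \<bullet> v = (\<Sum>k = 0..<N. if k = \<sigma> i then s i * v $ k else 0)"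
    unfolding scalar_prod_def using assms
    by (intro sum.cong) (auto simp: monomial_mat_def)
  thus ?thesis using assms by simp
qed

text \<open>Rows are followed from left to right: row \<open>c\<close> leads to
  \<open>\<sigma> c\<close> in the first factor and from there to \<open>\<tau> (\<sigma> c)\<close>
  in the second, which is why the maps compose in reverse order.\<close>

lemma monomial_mat_mult:
  assumes "\<And>c. c < N \<Longrightarrow> \<sigma> c < N"
  shows "monomial_mat N \<sigma> s * monomial_mat N \<tau> t = monomial_mat N (\<tau> \<circ> \<sigma>) (\<lambda>c. s c * t (\<sigma> c))"
    (is "?A * ?B = ?C")
proof (rule eq_matI)
  fix i j assume "i < dim_row ?C" "j < dim_col ?C"
  hence ij: "i < N" "j < N" by simp_all
  have "(?A * ?B) $$ (i, j) = row ?A i \<bullet> col ?B j" using ij by simp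
  also have "\<dots> = s i * col ?B j $ \<sigma> i"
    using ij assms col_dim[of ?B] unfolding dim_monomial_mat
    by (intro monomial_mat_row_scalar_prod)
  also have "\<dots> = ?C $$ (i, j)" using ij assms by (simp add: monomial_mat_def)
  finally show "(?A * ?B) $$ (i, j) = ?C $$ (i, j)" .
qed simp_all

lemma monomial_mat_cong:
  "(\<And>c. c < N \<Longrightarrow> \<sigma> c = \<tau> c) \<Longrightarrow> (\<And>c. c < N \<Longrightarrow> s c = t c) \<Longrightarrow>
    monomial_mat N \<sigma> s = monomial_mat N \<tau> t"
  by (auto simp: monomial_mat_def)

lemma monomial_mat_mult_vec:
  assumes "\<And>c. c < N \<Longrightarrow> \<sigma> c < N" "\<psi> \<in> carrier_vec N"
  shows "monomial_mat N \<sigma> s *\<^sub>v \<psi> = vec N (\<lambda>c. s c * \<psi> $ \<sigma> c)"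
  using assms by (intro eq_vecI) (simp_all add: monomial_mat_row_scalar_prod)

text \<open>A basis state number is read as the set of its qubits in state 1, via \<^const>\<open>set_decode\<close>.\<close>

definition flip :: "nat set \<Rightarrow> nat \<Rightarrow> nat" where
  "flip x c = set_encode (sym_diff (set_decode c) x)"

lemma set_decode_flip [simp]: "finite x \<Longrightarrow> set_decode (flip x c) = sym_diff (set_decode c) x"
  by (simp add: flip_def)

lemma flip_less: "x \<subseteq> {..<n} \<Longrightarrow> c < 2 ^ n \<Longrightarrow> flip x c < 2 ^ n"
  using finite_subset[of x "{..<n}"] by (auto simp: less_power2_iff_set_decode)

lemma set_decode_eq_iff: "set_decode c = set_decode d \<longleftrightarrow> c = d"
  by (metis set_decode_inverse)

lemma flip_commute: "finite x \<Longrightarrow> finite y \<Longrightarrow> flip x (flip y c) = flip y (flip x c)"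
  unfolding set_decode_eq_iff[symmetric] by auto

text \<open>For \<open>x\<close> below \<open>n\<close> the right half is zero, so this encodes X on
  the qubits in \<open>x\<close> and the identity elsewhere; \<open>zpart\<close> is the counterpart
  for Z.\<close>

definition xpart :: "nat \<Rightarrow> nat set \<Rightarrow> bit vec" where
  "xpart n x = vec (2 * n) (\<lambda>j. of_bool (j \<in> x))"

definition zpart :: "nat \<Rightarrow> nat set \<Rightarrow> bit vec" where
  "zpart n z = vec (2 * n) (\<lambda>j. of_bool (n \<le> j \<and> j - n \<in> z))"

lemma div_power2_mod2: "c div 2 ^ j mod 2 = of_bool (j \<in> set_decode c)"
  by (simp add: set_decode_def mod_2_eq_odd)

lemma prod_indicator:
  "(\<Prod>j<n. if P j then 1 else 0 :: 'a::comm_semiring_1) = (if \<forall>j<n. P j then 1 else 0)"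
  for n :: nat
  by (induction n) (auto simp: less_Suc_eq)

text \<open>The factor at qubit \<open>j\<close> is 1 or 0 according to whether the digits of
  \<open>c\<close> and \<open>d\<close> differ exactly when \<open>j\<close> lies in
  \<open>x\<close>. The product is thus the indicator of \<open>d = flip x c\<close>.\<close>

lemma pauli_operator_xpart:
  assumes "x \<subseteq> {..<n}"
  shows "pauli_operator n (xpart n x) = monomial_mat (2 ^ n) (flip x) (\<lambda>_. 1)"
  unfolding pauli_operator_def monomial_mat_def
proof (rule cong_mat[OF refl refl], unfold prod.case)
  fix c d :: nat assume cd: "c < 2 ^ n" "d < 2 ^ n"
  have fin: "finite x" using assms finite_subset by blast
  have "(\<Prod>j<n. pauli (xpart n x $ j) (xpart n x $ (n + j)) $$ (c div 2 ^ j mod 2, d div 2 ^ j mod 2)) =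
    (\<Prod>j<n. if (j \<in> set_decode d) = (j \<in> sym_diff (set_decode c) x) then 1 else (0 :: complex))"
    using assms
    by (intro prod.cong)
      (auto simp: xpart_def pauli_def div_power2_mod2 mat_of_rows_list_def of_bool_def subset_iff)
  also have "\<dots> = (if \<forall>j<n. (j \<in> set_decode d) = (j \<in> sym_diff (set_decode c) x) then 1 else 0)"
    by (rule prod_indicator)
  \<comment> \<open>All digits from position \<open>n\<close> on are zero, so agreement on the first
    \<open>n\<close> digits is equality of the sets.\<close>
  also have "(\<forall>j<n. (j \<in> set_decode d) = (j \<in> sym_diff (set_decode c) x)) \<longleftrightarrow>
      set_decode d = sym_diff (set_decode c) x"
    using cd assms unfolding less_power2_iff_set_decode by (auto simp: set_eq_iff subset_iff)
  also have "\<dots> \<longleftrightarrow> d = flip x c"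
    using set_decode_eq_iff[of d "flip x c"] fin by simp
  finally show "(\<Prod>j<n. pauli (xpart n x $ j) (xpart n x $ (n + j)) $$ (c div 2 ^ j mod 2, d div 2 ^ j mod 2)) =
    (if d = flip x c then 1 else 0)" .
qed

text \<open>Each factor splits into the indicator of equal digits and a sign, which is -1 exactly at
  qubits of \<open>z\<close> in state 1. Off the diagonal the indicator already makes the product
  0.\<close>

lemma pauli_operator_zpart:
  assumes "z \<subseteq> {..<n}"
  shows "pauli_operator n (zpart n z) = monomial_mat (2 ^ n) id (\<lambda>c. (-1) ^ card (set_decode c \<inter> z))"
  unfolding pauli_operator_def monomial_mat_def
proof (rule cong_mat[OF refl refl], unfold prod.case)
  fix c d :: nat assume cd: "c < 2 ^ n" "d < 2 ^ n"
  have "(\<Prod>j<n. pauli (zpart n z $ j) (zpart n z $ (n + j)) $$ (c div 2 ^ j mod 2, d div 2 ^ j mod 2)) =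
    (\<Prod>j<n. (if (j \<in> set_decode d) = (j \<in> set_decode c) then 1 else (0 :: complex)) *
      (if j \<in> set_decode c \<inter> z then -1 else 1))"
    by (intro prod.cong)
      (auto simp: zpart_def pauli_def div_power2_mod2 mat_of_rows_list_def of_bool_def)
  also have "\<dots> = (\<Prod>j<n. if (j \<in> set_decode d) = (j \<in> set_decode c) then 1 else 0) *
      (\<Prod>j<n. if j \<in> set_decode c \<inter> z then -1 else 1)"
    by (rule prod.distrib)
  also have "(\<Prod>j<n. if j \<in> set_decode c \<inter> z then -1 else (1 :: complex)) =
      (\<Prod>j\<in>set_decode c \<inter> z. -1)"
    using assms by (intro prod.mono_neutral_cong_right) auto
  also have "\<dots> = (-1) ^ card (set_decode c \<inter> z)" by simp
  also have "(\<Prod>j<n. if (j \<in> set_decode d) = (j \<in> set_decode c) then 1 else (0 :: complex)) =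
      (if \<forall>j<n. (j \<in> set_decode d) = (j \<in> set_decode c) then 1 else 0)"
    by (rule prod_indicator)
  also have "(\<forall>j<n. (j \<in> set_decode d) = (j \<in> set_decode c)) \<longleftrightarrow> set_decode d = set_decode c"
    using cd unfolding less_power2_iff_set_decode by (auto simp: set_eq_iff subset_iff)
  finally show "(\<Prod>j<n. pauli (zpart n z $ j) (zpart n z $ (n + j)) $$ (c div 2 ^ j mod 2, d div 2 ^ j mod 2)) =
    (if d = id c then (-1) ^ card (set_decode c \<inter> z) else 0)"
    by (simp add: set_decode_eq_iff)
qed

subsection \<open>The quantum code of a partition\<close>

text \<open>The symmetric difference has \<open>card A + card B\<close> elements minus twice the
  size of the intersection.\<close>

lemma even_card_sym_diff:
  assumes "finite A" "finite B" "even (card B)"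
  shows "even (card (sym_diff A B)) \<longleftrightarrow> even (card A)"
proof -
  have "card (sym_diff A B) = card (A - B) + card (B - A)"
    using assms by (intro card_Un_disjoint) auto
  moreover have "card A = card (A - B) + card (A \<inter> B)" "card B = card (B - A) + card (A \<inter> B)"
    using assms by (metis card_Diff_subset_Int card_mono finite_Int inf_le1 inf_le2 inf_commute
      le_add_diff_inverse2)+
  ultimately show ?thesis using assms(3) by (metis even_add)
qed

context even_partition
begin

abbreviation S :: "bit mat" where
  "S \<equiv> css_stabilizer H"

lemma dim_S: "dim_row S = 2 * r" "dim_col S = 2 * n"
  by (simp_all add: css_stabilizer_def)

lemma row_S:
  assumes "i < 2 * r"
  shows "row S i = (if i < r then xpart n (block i) else zpart n (block (i - r)))"
  using assms
  by (intro eq_vecI)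
    (auto simp: css_stabilizer_def xpart_def zpart_def partition_matrix_def four_block_mat_def Let_def)

text \<open>Flipping another block does not touch block \<open>l\<close>; flipping \<open>l\<close>
  itself is a symmetric difference with a set of even size. This is the reason why X and Z rows
  commute.\<close>

lemma even_card_flip_block:
  assumes "l < r" "k < r"
  shows "even (card (set_decode (flip (block k) c) \<inter> block l)) \<longleftrightarrow> even (card (set_decode c \<inter> block l))"
proof -
  have "set_decode (flip (block k) c) \<inter> block l =
      sym_diff (set_decode c \<inter> block l) (if k = l then block l else {})"
    by auto
  thus ?thesis using even_card_block[OF assms(1)] by (simp add: even_card_sym_diff)
qed

section \<open>Commutation of the X and Z operators\<close>

lemma block_subset: "block l \<subseteq> {..<n}"
  by auto

lemmas pauli_operator_x_row = pauli_operator_xpart[OF block_subset]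
lemmas pauli_operator_z_row = pauli_operator_zpart[OF block_subset]

lemma pauli_x_z_commute:
  assumes "k < r" "l < r"
  shows "pauli_operator n (xpart n (block k)) * pauli_operator n (zpart n (block l)) =
    pauli_operator n (zpart n (block l)) * pauli_operator n (xpart n (block k))"
  unfolding pauli_operator_x_row pauli_operator_z_row
  using assms even_card_flip_block[of l k]
  by (subst (1 2) monomial_mat_mult; (intro monomial_mat_cong)?)
    (auto simp: flip_less[OF block_subset] minus_one_power_iff)

lemma pauli_x_x_commute:
  "pauli_operator n (xpart n (block k)) * pauli_operator n (xpart n (block l)) =
    pauli_operator n (xpart n (block l)) * pauli_operator n (xpart n (block k))"
  unfolding pauli_operator_x_row
  by (subst (1 2) monomial_mat_mult; (intro monomial_mat_cong)?)
    (simp_all add: flip_less[OF block_subset] flip_commute)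

lemma pauli_z_z_commute:
  "pauli_operator n (zpart n (block k)) * pauli_operator n (zpart n (block l)) =
    pauli_operator n (zpart n (block l)) * pauli_operator n (zpart n (block k))"
  unfolding pauli_operator_z_row
  by (subst (1 2) monomial_mat_mult; (intro monomial_mat_cong)?) (simp_all add: mult.commute)

lemma commuting_stabilizer_S: "commuting_stabilizer n S"
  unfolding commuting_stabilizer_def dim_S
proof (intro conjI allI impI refl)
  fix i j assume ij: "i < 2 * r" "j < 2 * r"
  show "pauli_operator n (row S i) * pauli_operator n (row S j) =
      pauli_operator n (row S j) * pauli_operator n (row S i)"
    unfolding row_S[OF ij(1)] row_S[OF ij(2)] using ij
    by (auto simp: pauli_x_x_commute pauli_z_z_commute pauli_x_z_commute)
qed

section \<open>Vectors fixed by the stabilizer\<close>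

definition balanced :: "nat \<Rightarrow> bool" where
  "balanced c \<longleftrightarrow> (\<forall>l<r. even (card (set_decode c \<inter> block l)))"

lemma balanced_flip_block: "l < r \<Longrightarrow> balanced (flip (block l) c) \<longleftrightarrow> balanced c"
  unfolding balanced_def using even_card_flip_block by blast

text \<open>An X row permutes the coefficients by a block flip. A Z row multiplies coefficient
  \<open>c\<close> by a sign, and a coefficient with sign -1 can only be fixed if it is
  zero.\<close>

lemma mem_quantum_code_iff:
  "\<psi> \<in> quantum_code n S \<longleftrightarrow> \<psi> \<in> carrier_vec (2 ^ n) \<and>
     (\<forall>l<r. \<forall>c<2 ^ n. \<psi> $ flip (block l) c = \<psi> $ c) \<and>
     (\<forall>c<2 ^ n. \<not> balanced c \<longrightarrow> \<psi> $ c = 0)"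
proof -
  have "(\<forall>i<2 * r. pauli_operator n (row S i) *\<^sub>v \<psi> = \<psi>) \<longleftrightarrow>
      (\<forall>l<r. \<forall>c<2 ^ n. \<psi> $ flip (block l) c = \<psi> $ c) \<and>
      (\<forall>c<2 ^ n. \<not> balanced c \<longrightarrow> \<psi> $ c = 0)" if \<psi>: "\<psi> \<in> carrier_vec (2 ^ n)"
  proof -
    have x: "pauli_operator n (xpart n (block l)) *\<^sub>v \<psi> = \<psi> \<longleftrightarrow>
        (\<forall>c<2 ^ n. \<psi> $ flip (block l) c = \<psi> $ c)" for l
      unfolding pauli_operator_x_row
      using \<psi> by (subst monomial_mat_mult_vec) (auto simp: vec_eq_iff flip_less[OF block_subset])
    have neg: "- z = z \<longleftrightarrow> z = 0" for z :: complex
      by (simp add: complex_eq_iff)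
    have z: "pauli_operator n (zpart n (block l)) *\<^sub>v \<psi> = \<psi> \<longleftrightarrow>
        (\<forall>c<2 ^ n. odd (card (set_decode c \<inter> block l)) \<longrightarrow> \<psi> $ c = 0)" for l
      unfolding pauli_operator_z_row
      using \<psi> by (subst monomial_mat_mult_vec) (auto simp: vec_eq_iff minus_one_power_iff neg)
    have "(\<forall>i<2 * r. pauli_operator n (row S i) *\<^sub>v \<psi> = \<psi>) \<longleftrightarrow>
        (\<forall>l<r. pauli_operator n (xpart n (block l)) *\<^sub>v \<psi> = \<psi>) \<and>
        (\<forall>l<r. pauli_operator n (zpart n (block l)) *\<^sub>v \<psi> = \<psi>)" (is "?A \<longleftrightarrow> ?B \<and> ?C")
    proof (intro iffI conjI allI impI)
      fix l assume A: ?A and l: "l < r"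
      show "pauli_operator n (xpart n (block l)) *\<^sub>v \<psi> = \<psi>"
        using A[rule_format, of l] l row_S[of l] by simp
      show "pauli_operator n (zpart n (block l)) *\<^sub>v \<psi> = \<psi>"
        \<comment> \<open>The Z row of block \<open>l\<close> stands below the \<open>r\<close> X
          rows.\<close>
        using A[rule_format, of "r + l"] l row_S[of "r + l"] by simp
    next
      fix i assume "?B \<and> ?C" "i < 2 * r"
      thus "pauli_operator n (row S i) *\<^sub>v \<psi> = \<psi>" using row_S[of i] by simp
    qed
    thus ?thesis unfolding x z balanced_def by blast
  qed
  thus ?thesis unfolding quantum_code_def dim_S by blast
qed

lemma linear_subspace_quantum_code: "linear_subspace (2 ^ n) (quantum_code n S)"
  unfolding linear_subspace_iff mem_quantum_code_iff subset_iff
  by (auto simp: flip_less[OF block_subset] mem_quantum_code_iff)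

section \<open>Orbits of basis states under block flips\<close>

text \<open>
  The canonical representative of a basis state modulo flips of blocks: every block is flipped
  that contains its chosen point \<open>a l\<close>.
\<close>

definition reduce :: "nat set \<Rightarrow> nat set" where
  "reduce A = {v. v < n \<and> (v \<in> A \<longleftrightarrow> a (f v) \<notin> A)}"

text \<open>A point belongs to \<open>reduce A\<close> iff its membership in \<open>A\<close>
  differs from that of the chosen point of its block. Flipping block \<open>l\<close> toggles both
  memberships for points of that block and neither for the others.\<close>

lemma reduce_sym_diff_block:
  assumes "l < r"
  shows "reduce (sym_diff A (block l)) = reduce A"
  using assms f_a a_less f_less by (auto simp: reduce_def)

lemma reduce_eq:
  assumes "A \<subseteq> {..<n}"
  shows "reduce A = sym_diff A (\<Union>l\<in>{l. l < r \<and> a l \<in> A}. block l)"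
  using assms f_less by (auto simp: reduce_def)

lemma a_notin_reduce: "l < r \<Longrightarrow> a l \<notin> reduce A"
  by (simp add: reduce_def f_a)

lemma reduce_id:
  "A \<subseteq> {..<n} \<Longrightarrow> (\<And>l. l < r \<Longrightarrow> a l \<notin> A) \<Longrightarrow> reduce A = A"
  using f_less by (auto simp: reduce_def)

text \<open>Blocks are disjoint, so flipping a union amounts to flipping its blocks one after the
  other. This drives the inductions over sets of blocks.\<close>

lemma flip_insert_block:
  assumes "finite L" "l \<notin> L"
  shows "flip (\<Union>k\<in>insert l L. block k) c = flip (block l) (flip (\<Union>k\<in>L. block k) c)"
proof -
  have "set_decode (flip (\<Union>k\<in>insert l L. block k) c) =
      set_decode (flip (block l) (flip (\<Union>k\<in>L. block k) c))"
    using assms by auto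
  thus ?thesis by (simp only: set_decode_eq_iff)
qed

lemma quantum_code_flip_blocks:
  assumes "\<psi> \<in> quantum_code n S" "c < 2 ^ n" "finite L" "L \<subseteq> {..<r}"
  shows "\<psi> $ flip (\<Union>l\<in>L. block l) c = \<psi> $ c"
  using assms(3,4)
proof (induction L rule: finite_induct)
  case empty
  show ?case by (simp add: flip_def)
next
  case (insert l L)
  have "flip (\<Union>k\<in>L. block k) c < 2 ^ n" using assms(2) by (intro flip_less) auto
  thus ?case
    using assms(1) insert unfolding flip_insert_block[OF insert.hyps] by (simp add: mem_quantum_code_iff)
qed

lemma balanced_flip_blocks:
  assumes "finite L" "L \<subseteq> {..<r}"
  shows "balanced (flip (\<Union>l\<in>L. block l) c) \<longleftrightarrow> balanced c"
  using assms
proof (induction L rule: finite_induct)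
  case empty
  show ?case by (simp add: flip_def)
next
  case (insert l L)
  show ?case
    using insert unfolding flip_insert_block[OF insert.hyps] by (simp add: balanced_flip_block)
qed

lemma flip_blocks_eq_reduce:
  assumes "c < 2 ^ n"
  shows "set_decode (flip (\<Union>l\<in>{l. l < r \<and> a l \<in> set_decode c}. block l) c) = reduce (set_decode c)"
  using reduce_eq[of "set_decode c"] assms by (subst set_decode_flip) (auto simp: less_power2_iff_set_decode)

definition representatives :: "nat set" where
  "representatives = {c. c < 2 ^ n \<and> balanced c \<and> (\<forall>l<r. a l \<notin> set_decode c)}"

text \<open>The representatives form an information set: \<open>e j\<close> is the indicator of the
  orbit of \<open>j\<close>, and a code vector vanishing on all representatives vanishes on every
  balanced state by flip invariance.\<close>

lemma subspace_dim_quantum_code: "subspace_dim (2 ^ n) (quantum_code n S) = card representatives"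
proof -
  interpret vec_space "TYPE(complex)" "2 ^ n" .
  define e :: "nat \<Rightarrow> complex vec" where
    "e j = vec (2 ^ n) (\<lambda>c. if balanced c \<and> reduce (set_decode c) = set_decode j then 1 else 0)" for j
  show ?thesis
  proof (rule subspace_dim_information_set[OF linear_subspace_quantum_code])
    show "representatives \<subseteq> {..<2 ^ n}" by (auto simp: representatives_def)
    fix j assume j: "j \<in> representatives"
    show "e j \<in> quantum_code n S"
      by (auto simp: mem_quantum_code_iff e_def balanced_flip_block flip_less[OF block_subset] reduce_sym_diff_block)
    fix i assume i: "i \<in> representatives"
    have "reduce (set_decode i) = set_decode i"
      using i by (intro reduce_id) (auto simp: representatives_def less_power2_iff_set_decode)
    thus "e j $ i = (if i = j then 1 else 0)"
      using i by (simp add: e_def representatives_def set_decode_eq_iff)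
  next
    fix \<psi> assume \<psi>: "\<psi> \<in> quantum_code n S" and zero: "\<And>j. j \<in> representatives \<Longrightarrow> \<psi> $ j = 0"
    have "\<psi> $ c = 0" if c: "c < 2 ^ n" for c
    proof (cases "balanced c")
      case True
      \<comment> \<open>Flipping exactly the blocks whose chosen point is in state 1 leads from
        \<open>c\<close> to its representative.\<close>
      define L where "L = {l. l < r \<and> a l \<in> set_decode c}"
      let ?d = "flip (\<Union>l\<in>L. block l) c"
      have L: "finite L" "L \<subseteq> {..<r}" by (auto simp: L_def)
      have "?d < 2 ^ n" using c by (intro flip_less) auto
      moreover have "balanced ?d" using balanced_flip_blocks[OF L] True by simp
      moreover have "set_decode ?d = reduce (set_decode c)"
        unfolding L_def by (rule flip_blocks_eq_reduce[OF c])
      ultimately have "?d \<in> representatives"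
        by (simp add: representatives_def a_notin_reduce)
      thus ?thesis using quantum_code_flip_blocks[OF \<psi> c L] zero by simp
    qed (use \<psi> c in \<open>auto simp: mem_quantum_code_iff\<close>)
    thus "\<psi> = 0\<^sub>v (2 ^ n)" using \<psi> by (intro eq_vecI) (auto simp: mem_quantum_code_iff)
  qed
qed

section \<open>Counting the orbit representatives\<close>

definition free_points :: "nat set" where
  "free_points = {..<n} - (a ` {..<r} \<union> b ` {..<r})"

text \<open>A representative is determined by its free points, the parity of a block deciding on \<open>b l\<close>.\<close>

definition complete :: "nat set \<Rightarrow> nat set" where
  "complete T = T \<union> {b l | l. l < r \<and> odd (card (T \<inter> block l))}"

lemma card_chosen_points: "card (a ` {..<r} \<union> b ` {..<r}) = 2 * r"
  using a_neq_b' by (subst card_Un_disjoint) (auto simp: card_image inj_on_a inj_on_b)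

lemma card_free_points: "card free_points = n - 2 * r"
  unfolding free_points_def card_chosen_points[symmetric]
  using a_less b_less by (subst card_Diff_subset) auto

text \<open>Every point of block \<open>l\<close> except \<open>a l\<close> and \<open>b l\<close>
  is free, and \<open>a l\<close> is not in \<open>A\<close>.\<close>

lemma card_block_split:
  assumes "l < r" "A \<subseteq> {..<n}" "a l \<notin> A"
  shows "card (A \<inter> block l) = card (A \<inter> free_points \<inter> block l) + of_bool (b l \<in> A)"
proof -
  have "A \<inter> block l = (A \<inter> free_points \<inter> block l) \<union> (if b l \<in> A then {b l} else {})"
    using assms f_a f_b b_less by (auto simp: free_points_def)
  moreover have "b l \<notin> free_points" using assms by (simp add: free_points_def)
  ultimately show ?thesis by (simp split: if_splits)
qed

text \<open>Since every block has even weight and \<open>a l\<close> is absent, \<open>b l\<close>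
  is present exactly when the number of free points in the block is odd.\<close>

lemma complete_free:
  assumes "c \<in> representatives"
  shows "complete (set_decode c \<inter> free_points) = set_decode c"
proof -
  have c: "set_decode c \<subseteq> {..<n}" "\<And>l. l < r \<Longrightarrow> a l \<notin> set_decode c"
    "\<And>l. l < r \<Longrightarrow> even (card (set_decode c \<inter> block l))"
    using assms by (auto simp: representatives_def balanced_def less_power2_iff_set_decode)
  have odd: "odd (card (set_decode c \<inter> free_points \<inter> block l)) \<longleftrightarrow> b l \<in> set_decode c" if "l < r" for l
    using card_block_split[OF that c(1) c(2)[OF that]] c(3)[OF that] by (auto split: if_splits)
  show ?thesis
  proof
    show "complete (set_decode c \<inter> free_points) \<subseteq> set_decode c"
      using odd by (auto simp: complete_def)
    show "set_decode c \<subseteq> complete (set_decode c \<inter> free_points)"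
    proof
      fix x assume x: "x \<in> set_decode c"
      then consider "x \<in> free_points" | l where "l < r" "x = b l"
        using c by (auto simp: free_points_def)
      thus "x \<in> complete (set_decode c \<inter> free_points)"
        using odd x by cases (auto simp: complete_def)
    qed
  qed
qed

text \<open>Adding \<open>b l\<close> repairs odd blocks without adding any \<open>a l\<close> or
  any free point. So completing is inverse to restricting to free points.\<close>

lemma complete_in_representatives:
  assumes "T \<subseteq> free_points"
  shows "set_encode (complete T) \<in> representatives" "complete T \<inter> free_points = T" "finite (complete T)"
proof -
  have sub: "complete T \<subseteq> {..<n}"
    using assms b_less by (auto simp: complete_def free_points_def)
  thus fin: "finite (complete T)" using finite_subset by blast
  show T: "complete T \<inter> free_points = T"
    using assms by (auto simp: complete_def free_points_def)
  have a: "a l \<notin> complete T" if "l < r" for l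
    using assms that a_neq_b' by (auto simp: complete_def free_points_def)
  have "b l \<in> complete T \<longleftrightarrow> odd (card (T \<inter> block l))" if "l < r" for l
    using assms that f_b by (auto simp: complete_def free_points_def) (metis f_b)+
  hence "even (card (complete T \<inter> block l))" if "l < r" for l
    using that card_block_split[OF that sub a[OF that]] T by simp
  thus "set_encode (complete T) \<in> representatives"
    using sub fin a by (simp add: representatives_def balanced_def less_power2_iff_set_decode)
qed

lemma card_representatives: "card representatives = 2 ^ (n - 2 * r)"
proof -
  have "bij_betw (\<lambda>c. set_decode c \<inter> free_points) representatives (Pow free_points)"
  proof (rule bij_betw_byWitness[where f' = "\<lambda>T. set_encode (complete T)"])
    show "\<forall>c\<in>representatives. set_encode (complete (set_decode c \<inter> free_points)) = c"
      by (simp add: complete_free)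
    show "\<forall>T\<in>Pow free_points. set_decode (set_encode (complete T)) \<inter> free_points = T"
      using complete_in_representatives by simp
    show "(\<lambda>T. set_encode (complete T)) ` Pow free_points \<subseteq> representatives"
      using complete_in_representatives by auto
  qed auto
  thus ?thesis
    using bij_betw_same_card card_free_points by (metis card_Pow finite_Diff finite_lessThan free_points_def)
qed

text \<open>Keeps the natural number \<open>n - 2 * r\<close> from being truncated, so that it
  equals \<open>2 * (n - r) - n\<close> over the integers.\<close>

lemma two_r_le_n: "2 * r \<le> n"
proof -
  have "card (a ` {..<r} \<union> b ` {..<r}) \<le> card {..<n}"
    using a_less b_less by (intro card_mono) auto
  thus ?thesis by (simp add: card_chosen_points)
qed

lemma quantum_code_parameters_S:
  assumes "0 < r"
  shows "quantum_code_parameters S n (n - 2 * r) 2"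
  unfolding quantum_code_parameters_def
proof (intro conjI exI)
  show "S = css_stabilizer H" ..
  show "parity_check_matrix H (mat_kernel H)" by (simp add: parity_check_matrix_def)
  show "linear_code (mat_kernel H) n (n - r) 2" by (rule linear_code_kernel[OF assms])
  show "int (n - 2 * r) = 2 * int (n - r) - int n" using two_r_le_n by simp
qed (simp_all add: commuting_stabilizer_S linear_subspace_quantum_code H_self_orthogonal
    subspace_dim_quantum_code card_representatives)

end

subsection \<open>Regular partitions from parallel classes\<close>

text \<open>Hiding \<open>f\<close> and recording only the common block size \<open>c\<close> gives
  a property preserved by concatenation, so the three cases are built from the incidence matrix and
  identity matrices.\<close>

definition regular_partition_matrix :: "bit mat \<Rightarrow> nat \<Rightarrow> nat \<Rightarrow> nat \<Rightarrow> bool" where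
  "regular_partition_matrix M r n c \<longleftrightarrow> (\<exists>f. M = partition_matrix r n f \<and>
     (\<forall>v<n. f v < r) \<and> (\<forall>l<r. card {v. v < n \<and> f v = l} = c))"

lemma regular_partition_matrix_one: "regular_partition_matrix (1\<^sub>m r) r r 1"
proof -
  have "{v. v < r \<and> v = l} = {l}" if "l < r" for l using that by auto
  moreover have "1\<^sub>m r = partition_matrix r r (\<lambda>v. v)"
    by (intro eq_matI) (auto simp: partition_matrix_def)
  ultimately show ?thesis unfolding regular_partition_matrix_def by (intro exI[of _ "\<lambda>v. v"]) simp
qed

text \<open>Block \<open>l\<close> of the result is block \<open>l\<close> of \<open>M\<close>
  together with block \<open>l\<close> of \<open>N\<close> shifted by \<open>n\<close>, a disjoint
  union.\<close>

lemma regular_partition_matrix_hconcat: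
  assumes "regular_partition_matrix M r n c" "regular_partition_matrix N r k d"
  shows "regular_partition_matrix (hconcat M N) r (n + k) (c + d)"
proof -
  obtain f where f: "M = partition_matrix r n f" "\<And>v. v < n \<Longrightarrow> f v < r"
    "\<And>l. l < r \<Longrightarrow> card {v. v < n \<and> f v = l} = c"
    using assms(1) by (auto simp: regular_partition_matrix_def)
  obtain g where g: "N = partition_matrix r k g" "\<And>v. v < k \<Longrightarrow> g v < r"
    "\<And>l. l < r \<Longrightarrow> card {v. v < k \<and> g v = l} = d"
    using assms(2) by (auto simp: regular_partition_matrix_def)
  let ?h = "\<lambda>v. if v < n then f v else g (v - n)"
  have "hconcat M N = partition_matrix r (n + k) ?h"
    by (intro eq_matI) (auto simp: f g hconcat_def partition_matrix_def)
  moreover have "?h v < r" if "v < n + k" for v using that f g by auto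
  moreover have "card {v. v < n + k \<and> ?h v = l} = c + d" if "l < r" for l
  proof -
    have "{v. v < n + k \<and> ?h v = l} = {v. v < n \<and> f v = l} \<union> (+) n ` {v. v < k \<and> g v = l}"
      (is "_ = ?A \<union> ?B")
    proof (intro equalityI subsetI)
      fix v assume v: "v \<in> {v. v < n + k \<and> ?h v = l}"
      show "v \<in> ?A \<union> ?B"
      proof (cases "v < n")
        case False
        hence "v = n + (v - n)" "v - n \<in> {v. v < k \<and> g v = l}" using v by auto
        thus ?thesis by blast
      qed (use v in simp)
    qed auto
    moreover have "card (?A \<union> ?B) = card ?A + card ?B" by (intro card_Un_disjoint) auto
    moreover have "card ?B = d" using g(3)[OF that] by (subst card_image) auto
    ultimately show ?thesis using f(3)[OF that] by simp
  qed
  ultimately show ?thesis unfolding regular_partition_matrix_def by blast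
qed

section \<open>Cosets as blocks of a partition of the points\<close>

lemma mem_coset_self: "linear_subspace m W \<Longrightarrow> x \<in> carrier_vec m \<Longrightarrow> x \<in> coset W x"
  unfolding linear_subspace_iff coset_def by (intro image_eqI[of _ _ "0\<^sub>v m"]) auto

lemma coset_subset: "linear_subspace m W \<Longrightarrow> x \<in> carrier_vec m \<Longrightarrow> coset W x \<subseteq> carrier_vec m"
  unfolding linear_subspace_iff coset_def by auto

text \<open>Moving the base point by \<open>w\<close> in \<open>W\<close> is absorbed by
  \<open>W\<close>, which contains \<open>w\<close> and its negative. Hence lines of a parallel
  class that share a point are equal.\<close>

lemma coset_eq:
  fixes W :: "'a::field vec set"
  assumes W: "linear_subspace m W" and u: "u \<in> carrier_vec m" and x: "x \<in> coset W u"
  shows "coset W x = coset W u"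
proof -
  note W' = W[unfolded linear_subspace_iff]
  obtain w where w: "w \<in> W" "x = u + w" using x by (auto simp: coset_def)
  have wc: "w \<in> carrier_vec m" using w W' by auto
  have "coset W x \<subseteq> coset W u"
  proof
    fix y assume "y \<in> coset W x"
    then obtain v where v: "v \<in> W" "y = x + v" by (auto simp: coset_def)
    have vc: "v \<in> carrier_vec m" using v W' by auto
    have "y = u + (w + v)" using v w u wc vc by (simp add: assoc_add_vec[of _ m])
    moreover have "w + v \<in> W" using v w W' by auto
    ultimately show "y \<in> coset W u" by (auto simp: coset_def)
  qed
  moreover have "coset W u \<subseteq> coset W x"
  proof
    fix y assume "y \<in> coset W u"
    then obtain v where v: "v \<in> W" "y = u + v" by (auto simp: coset_def)
    have vc: "v \<in> carrier_vec m" using v W' by auto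
    have "y = x + ((-1) \<cdot>\<^sub>v w + v)" using v w u wc vc by (intro eq_vecI) auto
    moreover have "(-1) \<cdot>\<^sub>v w + v \<in> W" using v w W' by blast
    ultimately show "y \<in> coset W x" unfolding coset_def by blast
  qed
  ultimately show ?thesis by blast
qed

lemma card_coset:
  fixes W :: "'a::field vec set"
  assumes W: "linear_subspace m W" and u: "u \<in> carrier_vec m"
  shows "card (coset W u) = card W"
proof -
  have "inj_on ((+) u) W"
  proof (rule inj_onI)
    fix v w assume vw: "v \<in> W" "w \<in> W" "u + v = u + w"
    hence "v \<in> carrier_vec m" "w \<in> carrier_vec m" using W by (auto simp: linear_subspace_iff)
    moreover from this have "v $ i = w $ i" if "i < m" for i
      using arg_cong[OF vw(3), of "\<lambda>x. x $ i"] u that by simp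
    ultimately show "v = w" by (intro eq_vecI) auto
  qed
  thus ?thesis unfolding coset_def by (rule card_image)
qed

lemma card_nth_mem:
  assumes "distinct xs" "X \<subseteq> set xs"
  shows "card {i. i < length xs \<and> xs ! i \<in> X} = card X"
proof -
  have "inj_on ((!) xs) {i. i < length xs \<and> xs ! i \<in> X}"
    using assms by (intro inj_onI) (auto simp: nth_eq_iff_index_eq)
  moreover have "(!) xs ` {i. i < length xs \<and> xs ! i \<in> X} = X"
    using assms by (auto simp: in_set_conv_nth image_iff subset_iff)
  ultimately show ?thesis by (metis card_image)
qed

text \<open>The block of a point is the index of the unique listed line through it. Lines are
  translates of \<open>W\<close>, which has as many elements as the field because its dimension is
  1.\<close>

lemma regular_partition_matrix_incidence:
  fixes W :: "'a::{field,finite} vec set"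
  assumes W: "linear_subspace m W" "subspace_dim m W = 1" and m: "1 \<le> m"
    and ls: "distinct ls" "set ls = parallel_class m W"
    and ps: "distinct ps" "set ps = carrier_vec m"
  shows "regular_partition_matrix (incidence_matrix ls ps)
    (CARD('a) ^ (m - 1)) (CARD('a) ^ m) CARD('a)"
proof -
  have len_ps: "length ps = CARD('a) ^ m"
    using distinct_card[OF ps(1)] ps(2) card_carrier_vec by metis
  have finW: "finite W"
    using W(1) finite_carrier_vec finite_subset unfolding linear_subspace_iff by blast
  have cardW: "card W = CARD('a)" using card_linear_subspace[OF W(1) finW] W(2) by simp
  have p: "ps ! v \<in> carrier_vec m" if "v < length ps" for v
    using that ps(2) nth_mem by blast
  have "\<exists>l<length ls. ls ! l = coset W (ps ! v)" if "v < length ps" for v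
    using p[OF that] ls(2) by (auto simp: parallel_class_def in_set_conv_nth[symmetric])
  then obtain f where f: "\<And>v. v < length ps \<Longrightarrow> f v < length ls \<and> ls ! f v = coset W (ps ! v)"
    by metis
  have line: "\<exists>u\<in>carrier_vec m. ls ! l = coset W u" if "l < length ls" for l
    using nth_mem[OF that] unfolding ls(2) parallel_class_def by auto
  have iff: "ps ! v \<in> ls ! l \<longleftrightarrow> f v = l" if v: "v < length ps" and l: "l < length ls" for v l
  proof
    assume mem: "ps ! v \<in> ls ! l"
    obtain u where "u \<in> carrier_vec m" "ls ! l = coset W u" using line[OF l] by blast
    hence "ls ! f v = ls ! l" using f[OF v] coset_eq[OF W(1)] mem by simp
    thus "f v = l" using f[OF v] l ls(1) nth_eq_iff_index_eq by blast
  next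
    assume "f v = l"
    thus "ps ! v \<in> ls ! l" using f[OF v] mem_coset_self[OF W(1) p[OF v]] by auto
  qed
  have card: "card {v. v < length ps \<and> f v = l} = CARD('a)" if l: "l < length ls" for l
  proof -
    obtain u where u: "u \<in> carrier_vec m" "ls ! l = coset W u" using line[OF l] by blast
    have "{v. v < length ps \<and> f v = l} = {v. v < length ps \<and> ps ! v \<in> ls ! l}"
      using iff[OF _ l] by auto
    also have "card \<dots> = card (ls ! l)"
      using coset_subset[OF W(1) u(1)] u(2) ps by (intro card_nth_mem) auto
    finally show ?thesis using card_coset[OF W(1) u(1)] u(2) cardW by simp
  qed
  \<comment> \<open>Counting the points line by line determines the number of lines.\<close>
  have "(\<Sum>l<length ls. card {v \<in> {..<length ps}. f v = l}) = length ps"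
    using f sum.group[of "{..<length ps}" "{..<length ls}" f "\<lambda>_. 1 :: nat"]
    by (simp add: image_subset_iff)
  hence "length ls * CARD('a) = CARD('a) ^ m"
    using card len_ps by simp
  also have "\<dots> = CARD('a) ^ (m - 1) * CARD('a)"
    using m by (metis One_nat_def Suc_pred less_eq_Suc_le power_Suc2)
  finally have len_ls: "length ls = CARD('a) ^ (m - 1)" by simp
  have "incidence_matrix ls ps = partition_matrix (length ls) (length ps) f"
    unfolding incidence_matrix_def partition_matrix_def using iff by (intro cong_mat) auto
  thus ?thesis
    unfolding regular_partition_matrix_def len_ls[symmetric] len_ps[symmetric]
    using f card by blast
qed

text \<open>A positive even block size is at least 2, so two distinct points can be chosen in every
  block as \<open>even_partition\<close> demands.\<close>

lemma quantum_code_parameters_regular_partition: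
  assumes M: "regular_partition_matrix M r n c" and "even c" "0 < c" "0 < r"
  shows "quantum_code_parameters (css_stabilizer M) n (n - 2 * r) 2"
proof -
  obtain f where f: "M = partition_matrix r n f" "\<And>v. v < n \<Longrightarrow> f v < r"
    "\<And>l. l < r \<Longrightarrow> card {v. v < n \<and> f v = l} = c"
    using M by (auto simp: regular_partition_matrix_def)
  have "2 \<le> c" using \<open>even c\<close> \<open>0 < c\<close> by (auto elim!: evenE)
  have "\<exists>x y. x < n \<and> f x = l \<and> y < n \<and> f y = l \<and> x \<noteq> y" if l: "l < r" for l
  proof -
    obtain B where "B \<subseteq> {v. v < n \<and> f v = l}" "card B = 2"
      using obtain_subset_with_card_n[of 2 "{v. v < n \<and> f v = l}"] f(3)[OF l] \<open>2 \<le> c\<close> by auto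
    thus ?thesis by (auto simp: card_2_iff)
  qed
  then obtain a b where "\<And>l. l < r \<Longrightarrow>
      a l < n \<and> f (a l) = l \<and> b l < n \<and> f (b l) = l \<and> a l \<noteq> b l"
    by metis
  then interpret even_partition n r f a b
    using f \<open>even c\<close> by unfold_locales auto
  show ?thesis unfolding f(1) by (rule quantum_code_parameters_S[OF \<open>0 < r\<close>])
qed

theorem theorem8:
  fixes p s q m t :: nat
    and Hs :: "nat \<Rightarrow> 'f::{field,finite} vec set set"
    and points :: "'f vec list"
    and lines :: "nat \<Rightarrow> 'f vec set list"
    and A S :: "nat \<Rightarrow> bit mat"
    and n3 k3 d3 :: nat
  assumes "prime p" and "s \<ge> 1" and "q = p ^ s" and "CARD('f) = q"
    and "m \<ge> 2" and "t = (q ^ m - 1) div (q - 1)"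
    and "bij_betw Hs {1..t} (parallel_classes m)"
    and "distinct points" and "set points = carrier_vec m"
    and "\<forall>i\<in>{1..t}. distinct (lines i) \<and> set (lines i) = Hs i"
    and "\<forall>i\<in>{1..t}. A i = incidence_matrix (lines i) points"
    and "\<forall>i\<in>{1..t}. S i = css_stabilizer (orth_matrix q m (A i))"
    and "(n3, k3, d3) =
      (if even q \<and> 4 \<le> q then (q ^ m, q ^ m - 2 * q ^ (m - 1), 2)
       else if odd q then (q ^ m + q ^ (m - 1), q ^ m - q ^ (m - 1), 2)
       else (2 ^ (m + 1), 2 ^ m, 2))"
  shows "\<forall>i\<in>{1..t}. quantum_code_parameters (S i) n3 k3 d3"
proof
  fix i assume i: "i \<in> {1..t}"
  let ?r = "q ^ (m - 1)"
  have q: "2 \<le> q"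
    using \<open>prime p\<close> \<open>s \<ge> 1\<close> \<open>q = p ^ s\<close> prime_ge_2_nat self_le_power[of p s]
    by (metis le_trans one_le_numeral less_eq_Suc_le One_nat_def)
  have qm: "q ^ m = q * ?r"
    using \<open>m \<ge> 2\<close> by (metis One_nat_def Suc_pred less_le_trans pos2 power_Suc)
  have r: "0 < ?r" using q by simp
  have "Hs i \<in> parallel_classes m"
    using \<open>bij_betw Hs {1..t} (parallel_classes m)\<close> i by (auto simp: bij_betw_def)
  then obtain W where "linear_subspace m W" "subspace_dim m W = 1" "Hs i = parallel_class m W"
    by (auto simp: parallel_classes_def)
  hence A: "regular_partition_matrix (A i) ?r (q ^ m) q"
    using regular_partition_matrix_incidence[of m W "lines i" points] assms i by simp
  note I = regular_partition_matrix_one[of ?r]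
  have S: "S i = css_stabilizer (orth_matrix q m (A i))" using assms i by blast
  note params = \<open>(n3, k3, d3) = _\<close>
  consider "even q" "4 \<le> q" | "odd q" | "q = 2"
    using q by (cases "even q"; cases "4 \<le> q") (auto elim!: evenE)
  thus "quantum_code_parameters (S i) n3 k3 d3"
  proof cases
    case 1
    thus ?thesis
      using params quantum_code_parameters_regular_partition[OF A _ _ r] q
      by (simp add: S orth_matrix_def)
  next
    case 2
    \<comment> \<open>The identity adds one point to each line, giving the even size
      \<open>q + 1\<close>; the exponent is \<open>q ^ m + ?r - 2 * ?r = q ^ m - ?r\<close>.\<close>
    thus ?thesis
      using params q quantum_code_parameters_regular_partition[
          OF regular_partition_matrix_hconcat[OF A I] _ _ r]
      by (simp add: S orth_matrix_def)
  next
    case 3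
    \<comment> \<open>Each line gets size \<open>2 + 1 + 1 = 4\<close>. Since
      \<open>2 * ?r = 2 ^ m\<close>, the length \<open>2 ^ m + 2 * ?r\<close> is
      \<open>2 ^ (m + 1)\<close>.\<close>
    thus ?thesis
      using params qm quantum_code_parameters_regular_partition[
          OF regular_partition_matrix_hconcat[OF A regular_partition_matrix_hconcat[OF I I]] _ _ r]
      by (simp add: S orth_matrix_def)
  qed
qed

end
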